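(* Consider the interconnected system $$x_{t+1}=x_t+\delta\,S(x_t,z_t),\qquad z_{t+1}=F(x_t,z_t),\qquad t\in\mathbb{N},$$ with $S:\mathbb{R}^n\times\mathbb{R}^m\to\mathbb{R}^n$, $F:\mathbb{R}^n\times\mathbb{R}^m\to\mathbb{R}^m$ and parameter $\delta>0$. Suppose the following hold. (1) There are closed sets $X\subseteq\mathbb{R}^n$, $Z\subseteq\mathbb{R}^m$ such that $x+\delta' S(x,z)\in X$ and $F(x,z)\in Z$ for all $x\in X$, $z\in Z$, $\delta'\in[0,1]$. (2) There is a set-valued map $Z_{\mathrm{FIX}}:X\rightrightarrows Z$ with $Z_{\mathrm{FIX}}(x)$ nonempty and closed for all $x\in X$, such that $\bar z=F(x,\bar z)$ for all $x\in X$ and $\bar z\in Z_{\mathrm{FIX}}(x)$; moreover there is $L_{\mathrm{FIX}}>0$ with $d_F(z,Z_{\mathrm{FIX}}(x'))\le L_{\mathrm{FIX}}\,d_S(x,x')$ for all $x,x'\in X$ and $z\in Z_{\mathrm{FIX}}(x)$. (3) There is $c_F\in(0,1)$ with $d_F(F(x,z),Z_{\mathrm{FIX}}(x))\le c_F\,d_F(z,Z_{\mathrm{FIX}}(x))$ for all $(x,z)\in X\times Z$. (4) There is $R:X\to\mathbb{R}^n$ with $R(x)=S(x,z)$ for all $x\in X$ and $z\in Z_{\mathrm{FIX}}(x)$. (5) There are $L_S,L_R>0$ with $\|S(x,z)-S(x,z')\|_S\le L_S\|z-z'\|_F$ and $\|R(x)-R(x')\|_S\le L_R\|x-x'\|_S$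 for all $(x,z),(x',z')\in X\times Z$. (6) The set $X_{\mathrm{fix}}:=\{x\in X\mid R(x)=0\}$ is nonempty and closed, and for some $\alpha\in(0,1)$ and $\mu\ge1$, $$d_S\!\left(x+\tfrac1\alpha R(x),\,x'+\tfrac1\alpha R(x')\right)\le\|x-x'\|_S,\qquad d_S(x,X_{\mathrm{fix}})\le\mu\|R(x)\|_S$$ for all $x,x'\in X$. Let $$c_S:=1-\sqrt{1-\frac{1-\alpha}{\alpha\mu^2}},\qquad \bar\delta:=\frac{c_S(1-c_F)}{L_{\mathrm{FIX}}L_S(c_S+L_R)}.$$ Then, for all $\delta\in(0,\min\{\bar\delta,1\})$, there exist $C>0$ and $\rho\in(0,1)$ such that the trajectories of the system satisfy $$\left\|\begin{bmatrix}d_S(x_t,X_{\mathrm{fix}})\\ d_F(z_t,Z_{\mathrm{FIX}}(x_t))\end{bmatrix}\right\|\le C\rho^t\left\|\begin{bmatrix}d_S(x_0,X_{\mathrm{fix}})\\ d_F(z_0,Z_{\mathrm{FIX}}(x_0))\end{bmatrix}\right\|$$ for all $(x_0,z_0)\in X\times Z$ and $t\in\mathbb{N}$.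
   Context: $\|\cdot\|_F$ and $\|\cdot\|_S$ are norms induced by inner products on $\mathbb{R}^m$ and $\mathbb{R}^n$ respectively, with distances $d_F(z,z')=\|z-z'\|_F$ and $d_S(x,x')=\|x-x'\|_S$. For sets, $d_F(z,Z')=\inf_{y\in Z'}d_F(z,y)$ and $d_S(x,X')=\inf_{y\in X'}d_S(x,y)$. $\|\cdot\|$ (no subscript) is the Euclidean norm. The constants $C,\rho$ do not depend on the initial condition or on $t$. *)

theory Defs
  imports "HOL-Analysis.Analysis"
begin

definition is_inner_product :: "('a::real_vector \<Rightarrow> 'a \<Rightarrow> real) \<Rightarrow> bool" where
  "is_inner_product B \<longleftrightarrow>
     bilinear B \<and> (\<forall>x y. B x y = B y x) \<and> (\<forall>x. x \<noteq> 0 \<longrightarrow> 0 < B x x)"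

definition is_inner_product_norm :: "('a::real_vector \<Rightarrow> real) \<Rightarrow> bool" where
  "is_inner_product_norm N \<longleftrightarrow>
     (\<exists>B. is_inner_product B \<and> (\<forall>x. N x = sqrt (B x x)))"

text \<open>The library's \<^const>\<open>dist\<close> and \<^const>\<open>infdist\<close> are tied to the norm of the type class;
  the two constants below are their analogues for an arbitrary norm \<open>N\<close>. As \<open>Inf {}\<close> on the reals
  is unspecified, \<open>norm_infdist N x A\<close> is only meaningful for \<open>A \<noteq> {}\<close>.\<close>

definition norm_dist :: "('a::real_vector \<Rightarrow> real) \<Rightarrow> 'a \<Rightarrow> 'a \<Rightarrow> real" where
  "norm_dist N x y = N (x - y)"

definition norm_infdist :: "('a::real_vector \<Rightarrow> real) \<Rightarrow> 'a \<Rightarrow> 'a set \<Rightarrow> real" where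
  "norm_infdist N x A = (INF y\<in>A. norm_dist N x y)"

definition is_trajectory ::
  "real \<Rightarrow> ('a::real_vector \<Rightarrow> 'b \<Rightarrow> 'a) \<Rightarrow> ('a \<Rightarrow> 'b \<Rightarrow> 'b) \<Rightarrow> (nat \<Rightarrow> 'a) \<Rightarrow> (nat \<Rightarrow> 'b) \<Rightarrow> bool" where
  "is_trajectory \<delta> S F x z \<longleftrightarrow>
     (\<forall>t. x (Suc t) = x t + \<delta> *\<^sub>R S (x t) (z t) \<and> z (Suc t) = F (x t) (z t))"

end

theory Submission
  imports Defs
begin

text \<open>Write \<open>d = norm_infdist normS x X_fix\<close> and \<open>e = norm_infdist normF z (Z_FIX x)\<close> for the two
  errors at the state \<open>(x, z)\<close>. The idea is to close a linear recursion for the pair \<open>(d, e)\<close>, where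
  primes mark the values at the next state:

  \<^item> \<open>d' \<le> (1 - \<delta> c_S) d + \<delta> L_S e\<close>
  \<^item> \<open>e' \<le> \<delta> L_FIX L_R d + (c_F + \<delta> L_FIX L_S) e\<close>

  The slow step \<open>x + \<delta> S x z\<close> is the ideal step \<open>x + \<delta> R x\<close> up to an error of norm at most
  \<open>\<delta> L_S e\<close>, because \<open>S\<close> is Lipschitz in \<open>z\<close> and equals \<open>R x\<close> on \<open>Z_FIX x\<close>
  (\<open>slow_field_error_le\<close>). The ideal step contracts: as \<open>x + R x / \<alpha>\<close> is nonexpansive, \<open>x + R x\<close> is
  averaged, which decreases the squared distance to a fixed point by \<open>(1 - \<alpha>) / \<alpha> * \<parallel>R x\<parallel>\<^sup>2\<close>
  (\<open>averaged_step_decrease\<close>), and the error bound \<open>d \<le> \<mu> \<parallel>R x\<parallel>\<close> makes this a fixed proportion of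
  \<open>d\<^sup>2\<close>. Hence a full step contracts \<open>d\<close> by \<open>1 - c_S\<close> and, by convexity, a step of size \<open>\<delta>\<close> contracts
  it by \<open>1 - \<delta> c_S\<close> (\<open>relaxed_step_contraction\<close>). The fast step contracts \<open>e\<close> by \<open>c_F\<close> as long as
  \<open>x\<close> stays put; moving \<open>x\<close> then displaces the target set by at most \<open>L_FIX\<close> times the length
  \<open>\<delta> \<parallel>S x z\<parallel> \<le> \<delta> (L_R d + L_S e)\<close> of the slow step.

  The matrix of this recursion has rows \<open>(1 - a, b)\<close> and \<open>(c, 1 - g)\<close> with nonnegative \<open>b\<close>, \<open>c\<close>,
  and the bound \<open>\<delta> < \<delta>_bar\<close> says precisely that \<open>b c < a g\<close>, which also forces \<open>g > 0\<close>. In that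
  case a weighted sum \<open>d + w e\<close> decays geometrically (\<open>coupled_recursion_decay\<close>).\<close>

section \<open>Norms induced by an inner product\<close>

lemma inner_product_norm_expand:
  assumes "is_inner_product_norm N"
  obtains B where "bilinear B" "\<And>x y. B x y = B y x" "\<And>x. 0 \<le> B x x"
    "\<And>x. x \<noteq> 0 \<Longrightarrow> 0 < B x x" "\<And>x. N x = sqrt (B x x)" "\<And>x. (N x)\<^sup>2 = B x x"
    "\<And>x y c. B (x + c *\<^sub>R y) (x + c *\<^sub>R y) = B x x + 2 * c * B x y + c\<^sup>2 * B y y"
proof -
  obtain B where B: "bilinear B" "\<And>x y. B x y = B y x" "\<And>x. x \<noteq> 0 \<Longrightarrow> 0 < B x x"
    "\<And>x. N x = sqrt (B x x)"
    using assms unfolding is_inner_product_norm_def is_inner_product_def by blast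
  have nn: "0 \<le> B x x" for x
    using B(3)[of x] bilinear_lzero[OF B(1), of x] by (cases "x = 0") auto
  have "B (x + c *\<^sub>R y) (x + c *\<^sub>R y) = B x x + 2 * c * B x y + c\<^sup>2 * B y y" for x y c
    using B(2)[of y x]
    by (simp add: bilinear_ladd[OF B(1)] bilinear_radd[OF B(1)] bilinear_lmul[OF B(1)]
        bilinear_rmul[OF B(1)] power2_eq_square algebra_simps)
  then show thesis
    using that[of B] B nn by simp
qed

lemma inner_product_norm_nonneg:
  assumes "is_inner_product_norm N"
  shows "0 \<le> N x"
  using assms by (rule inner_product_norm_expand) simp

lemma inner_product_norm_scaleR:
  assumes "is_inner_product_norm N"
  shows "N (c *\<^sub>R x) = \<bar>c\<bar> * N x"
  using assms
proof (rule inner_product_norm_expand)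
  fix B assume B: "bilinear B" "\<And>x. N x = sqrt (B x x)"
  show ?thesis
    by (simp add: B(2) bilinear_lmul[OF B(1)] bilinear_rmul[OF B(1)] real_sqrt_mult
        flip: mult.assoc)
qed

lemma inner_product_norm_minus:
  assumes "is_inner_product_norm N"
  shows "N (- x) = N x"
  using inner_product_norm_scaleR[OF assms, of "-1" x] by simp

lemma inner_product_norm_triangle:
  assumes "is_inner_product_norm N"
  shows "N (x + y) \<le> N x + N y"
  using assms
proof (rule inner_product_norm_expand)
  fix B assume B: "bilinear B" "\<And>x y. B x y = B y x" "\<And>x. 0 \<le> B x x"
    "\<And>x. x \<noteq> 0 \<Longrightarrow> 0 < B x x" "\<And>x. N x = sqrt (B x x)" "\<And>x. (N x)\<^sup>2 = B x x"
    "\<And>x y c. B (x + c *\<^sub>R y) (x + c *\<^sub>R y) = B x x + 2 * c * B x y + c\<^sup>2 * B y y"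
  have cauchy_schwarz: "(B x y)\<^sup>2 \<le> B x x * B y y"
  proof (cases "y = 0")
    case True
    then show ?thesis using bilinear_rzero[OF B(1)] by simp
  next
    case False
    then have pos: "0 < B y y" by (rule B(4))
    \<comment> \<open>the coefficient that makes \<open>x + c y\<close> orthogonal to \<open>y\<close>\<close>
    define c where "c = - B x y / B y y"
    have "0 \<le> B x x + 2 * c * B x y + c\<^sup>2 * B y y"
      using B(3)[of "x + c *\<^sub>R y"] B(7) by simp
    also have "\<dots> = B x x - (B x y)\<^sup>2 / B y y"
      using pos by (simp add: c_def power2_eq_square)
    finally show ?thesis
      using pos by (simp add: field_simps)
  qed
  have "B x y \<le> sqrt ((B x y)\<^sup>2)" by simp
  also have "\<dots> \<le> N x * N y"
    using cauchy_schwarz by (simp only: B(5) real_sqrt_mult[symmetric] real_sqrt_le_mono)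
  finally have "B x y \<le> N x * N y" .
  then have "(N (x + y))\<^sup>2 \<le> (N x + N y)\<^sup>2"
    using B(7)[of x 1 y] by (simp add: B(6) power2_sum)
  moreover have "0 \<le> N x + N y"
    using inner_product_norm_nonneg[OF assms] by simp
  ultimately show ?thesis
    by (rule power2_le_imp_le)
qed

text \<open>An averaged map does not merely keep distances to its fixed points from growing, every step
  that moves the point shrinks them strictly. Here \<open>u\<close> is the position relative to a fixed point and
  \<open>r\<close> the displacement: if even the over-relaxed step \<open>r / \<alpha>\<close> does not lead away from the fixed
  point, then the angle between \<open>u\<close> and \<open>r\<close> is so obtuse that the step \<open>r\<close> itself makes definite
  progress.\<close>

lemma averaged_step_decrease:
  assumes N: "is_inner_product_norm N" and "0 < \<alpha>"
    and le: "N (u + (1 / \<alpha>) *\<^sub>R r) \<le> N u"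
  shows "(N (u + r))\<^sup>2 \<le> (N u)\<^sup>2 - (1 - \<alpha>) / \<alpha> * (N r)\<^sup>2"
  using N
proof (rule inner_product_norm_expand)
  fix B assume B: "\<And>x. (N x)\<^sup>2 = B x x"
    "\<And>x y c. B (x + c *\<^sub>R y) (x + c *\<^sub>R y) = B x x + 2 * c * B x y + c\<^sup>2 * B y y"
  have "(N (u + (1 / \<alpha>) *\<^sub>R r))\<^sup>2 \<le> (N u)\<^sup>2"
    using le inner_product_norm_nonneg[OF N] by (rule power_mono)
  then have "2 * (1 / \<alpha>) * B u r + (1 / \<alpha>)\<^sup>2 * B r r \<le> 0"
    by (simp only: B)
  then have "\<alpha> * (2 * (1 / \<alpha>) * B u r + (1 / \<alpha>)\<^sup>2 * B r r) \<le> 0"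
    using \<open>0 < \<alpha>\<close> by (intro mult_nonneg_nonpos) simp_all
  then have "2 * B u r + B r r / \<alpha> \<le> 0"
    using \<open>0 < \<alpha>\<close> by (simp add: distrib_left power2_eq_square)
  moreover have "(N (u + r))\<^sup>2 = (N u)\<^sup>2 + 2 * B u r + (N r)\<^sup>2"
    using B(2)[of u 1 r] by (simp add: B(1))
  moreover have "(1 - \<alpha>) / \<alpha> * (N r)\<^sup>2 = B r r / \<alpha> - B r r"
    using \<open>0 < \<alpha>\<close> by (simp add: B(1) field_simps)
  ultimately show ?thesis
    by (simp add: B(1))
qed

section \<open>Distance to a set\<close>

lemma norm_dist_bdd_below:
  assumes "is_inner_product_norm N"
  shows "bdd_below (norm_dist N x ` A)"
  by (rule bdd_belowI[of _ 0]) (auto simp: norm_dist_def inner_product_norm_nonneg[OF assms])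

lemma norm_infdist_le:
  assumes "is_inner_product_norm N" "y \<in> A"
  shows "norm_infdist N x A \<le> N (x - y)"
  using cINF_lower[OF norm_dist_bdd_below[OF assms(1)] assms(2)]
  by (simp add: norm_infdist_def norm_dist_def)

lemma norm_infdist_greatest:
  assumes "A \<noteq> {}" "\<And>y. y \<in> A \<Longrightarrow> b \<le> N (x - y)"
  shows "b \<le> norm_infdist N x A"
  unfolding norm_infdist_def using assms by (intro cINF_greatest) (auto simp: norm_dist_def)

lemma norm_infdist_nonneg:
  assumes "is_inner_product_norm N" "A \<noteq> {}"
  shows "0 \<le> norm_infdist N x A"
  using assms by (intro norm_infdist_greatest inner_product_norm_nonneg)

text \<open>A bound in terms of the distance to each single point of \<open>A\<close> passes to the infimum by continuity;
  this takes the place of choosing a nearest point.\<close>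

lemma le_at_norm_infdist:
  fixes f :: "real \<Rightarrow> real"
  assumes N: "is_inner_product_norm N" and "A \<noteq> {}" and cont: "continuous_on UNIV f"
    and le: "\<And>y. y \<in> A \<Longrightarrow> b \<le> f (N (x - y))"
  shows "b \<le> f (norm_infdist N x A)"
proof -
  have "norm_infdist N x A \<in> closure (norm_dist N x ` A)"
    unfolding norm_infdist_def
    using \<open>A \<noteq> {}\<close> by (intro closure_contains_Inf norm_dist_bdd_below[OF N]) simp
  moreover have "closure (norm_dist N x ` A) \<subseteq> {a. b \<le> f a}"
    using le cont
    by (intro closure_minimal closed_Collect_le continuous_intros) (auto simp: norm_dist_def)
  ultimately show ?thesis by auto
qed

lemma norm_infdist_triangle:
  assumes N: "is_inner_product_norm N" and "A \<noteq> {}"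
  shows "norm_infdist N x A \<le> norm_infdist N y A + N (x - y)"
proof -
  have "norm_infdist N x A - N (x - y) \<le> N (y - a)" if "a \<in> A" for a
    using norm_infdist_le[OF N that, of x] inner_product_norm_triangle[OF N, of "x - y" "y - a"]
    by simp
  then have "norm_infdist N x A - N (x - y) \<le> norm_infdist N y A"
    by (rule norm_infdist_greatest[OF \<open>A \<noteq> {}\<close>])
  then show ?thesis by simp
qed

lemma norm_infdist_change_set:
  assumes N: "is_inner_product_norm N" and "A \<noteq> {}" and "A' \<noteq> {}"
    and le: "\<And>y. y \<in> A \<Longrightarrow> norm_infdist N y A' \<le> h"
  shows "norm_infdist N x A' \<le> norm_infdist N x A + h"
proof -
  have "norm_infdist N x A' - h \<le> N (x - y)" if "y \<in> A" for y
    using norm_infdist_triangle[OF N \<open>A' \<noteq> {}\<close>, of x y] le[OF that] by simp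
  then have "norm_infdist N x A' - h \<le> norm_infdist N x A"
    by (rule norm_infdist_greatest[OF \<open>A \<noteq> {}\<close>])
  then show ?thesis by simp
qed

section \<open>The ideal slow step\<close>

text \<open>For a fixed point \<open>y\<close> at distance \<open>a\<close> from \<open>x\<close>, the full step reaches distance at most
  \<open>sqrt (a\<^sup>2 - (1 - \<alpha>) / \<alpha> * (N r)\<^sup>2)\<close> and the error bound replaces \<open>N r\<close> by \<open>d / \<mu>\<close>, where \<open>d\<close> is the
  distance from \<open>x\<close> to \<open>A\<close>; letting \<open>a\<close> tend to \<open>d\<close> gives the factor \<open>1 - c\<close>. The real square root
  is monotone and multiplicative on all of the line, so this is correct even if the radicand
  in the rate is negative, which can only happen for \<open>d = 0\<close>.\<close>

lemma relaxed_step_contraction: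
  assumes N: "is_inner_product_norm N" and "A \<noteq> {}"
    and \<alpha>: "0 < \<alpha>" "\<alpha> < 1" and "0 < \<mu>" and \<delta>: "0 \<le> \<delta>" "\<delta> \<le> 1"
    and nonexp: "\<And>y. y \<in> A \<Longrightarrow> N (x - y + (1 / \<alpha>) *\<^sub>R r) \<le> N (x - y)"
    and error_bound: "norm_infdist N x A \<le> \<mu> * N r"
    and c: "c = 1 - sqrt (1 - (1 - \<alpha>) / (\<alpha> * \<mu>\<^sup>2))"
  shows "norm_infdist N (x + \<delta> *\<^sub>R r) A \<le> (1 - \<delta> * c) * norm_infdist N x A"
proof -
  define d where "d = norm_infdist N x A"
  define k where "k = (1 - \<alpha>) / (\<alpha> * \<mu>\<^sup>2)"
  define f where "f = (\<lambda>a. (1 - \<delta>) * a + \<delta> * sqrt (a\<^sup>2 - k * d\<^sup>2))"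
  have cont: "continuous_on UNIV f"
    unfolding f_def by (intro continuous_intros)
  have d0: "0 \<le> d"
    unfolding d_def using N \<open>A \<noteq> {}\<close> by (rule norm_infdist_nonneg)
  have "d\<^sup>2 \<le> (\<mu> * N r)\<^sup>2"
    using error_bound d0 unfolding d_def by (rule power_mono)
  then have "k * d\<^sup>2 \<le> k * (\<mu> * N r)\<^sup>2"
    using \<alpha> by (intro mult_left_mono) (simp_all add: k_def)
  also have "\<dots> = (1 - \<alpha>) / \<alpha> * (N r)\<^sup>2"
    using \<open>0 < \<mu>\<close> \<alpha> by (simp add: k_def power_mult_distrib)
  finally have k: "k * d\<^sup>2 \<le> (1 - \<alpha>) / \<alpha> * (N r)\<^sup>2" .
  have "norm_infdist N (x + \<delta> *\<^sub>R r) A \<le> f (N (x - y))" if y: "y \<in> A" for y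
  proof -
    have "(N (x - y + r))\<^sup>2 \<le> (N (x - y))\<^sup>2 - k * d\<^sup>2"
      using averaged_step_decrease[OF N \<alpha>(1) nonexp[OF y]] k by linarith
    then have full: "N (x - y + r) \<le> sqrt ((N (x - y))\<^sup>2 - k * d\<^sup>2)"
      by (rule real_le_rsqrt)
    have "norm_infdist N (x + \<delta> *\<^sub>R r) A \<le> N (x + \<delta> *\<^sub>R r - y)"
      using N y by (rule norm_infdist_le)
    also have "x + \<delta> *\<^sub>R r - y = (1 - \<delta>) *\<^sub>R (x - y) + \<delta> *\<^sub>R (x - y + r)"
      by (simp add: algebra_simps)
    also have "N \<dots> \<le> (1 - \<delta>) * N (x - y) + \<delta> * N (x - y + r)"
      using inner_product_norm_triangle[OF N, of "(1 - \<delta>) *\<^sub>R (x - y)" "\<delta> *\<^sub>R (x - y + r)"] \<delta>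
      by (simp add: inner_product_norm_scaleR[OF N])
    also have "\<dots> \<le> f (N (x - y))"
      unfolding f_def using full \<delta> by (intro add_left_mono mult_left_mono)
    finally show ?thesis .
  qed
  then have "norm_infdist N (x + \<delta> *\<^sub>R r) A \<le> f (norm_infdist N x A)"
    by (rule le_at_norm_infdist[OF N \<open>A \<noteq> {}\<close> cont])
  also have "\<dots> = f d"
    by (simp add: d_def)
  also have "\<dots> = (1 - \<delta> * c) * d"
  proof -
    have "sqrt (d\<^sup>2 - k * d\<^sup>2) = sqrt (1 - k) * d"
      using d0 real_sqrt_mult[of "1 - k" "d\<^sup>2"] by (simp add: left_diff_distrib)
    then show ?thesis
      by (simp add: f_def c k_def algebra_simps)
  qed
  finally show ?thesis by (simp add: d_def)
qed

lemma contraction_rate_pos: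
  fixes \<alpha> \<mu> :: real
  assumes "0 < \<alpha>" "\<alpha> < 1" "0 < \<mu>"
  shows "0 < 1 - sqrt (1 - (1 - \<alpha>) / (\<alpha> * \<mu>\<^sup>2))"
proof -
  have "0 < (1 - \<alpha>) / (\<alpha> * \<mu>\<^sup>2)"
    using assms by simp
  then show ?thesis by simp
qed

section \<open>Effect of the fast error on the slow step\<close>

lemma slow_field_error_le:
  assumes N: "is_inner_product_norm NF" and "A \<noteq> {}" and "A \<subseteq> Z" and "z \<in> Z"
    and "0 \<le> L"
    and lip: "\<And>z'. z' \<in> Z \<Longrightarrow> NS (s z - s z') \<le> L * NF (z - z')"
    and eq: "\<And>z'. z' \<in> A \<Longrightarrow> s z' = r"
  shows "NS (s z - r) \<le> L * norm_infdist NF z A"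
proof (rule le_at_norm_infdist[OF N \<open>A \<noteq> {}\<close>])
  show "NS (s z - r) \<le> L * NF (z - y)" if "y \<in> A" for y
    using lip[of y] eq[OF that] that \<open>A \<subseteq> Z\<close> by auto
qed (intro continuous_intros)

section \<open>Decay of a coupled recursion\<close>

lemma norm_vector_2: "norm (vector [a, b] :: real ^ 2) = sqrt (a\<^sup>2 + b\<^sup>2)"
  by (simp add: norm_vec_def L2_set_def sum_2)

text \<open>The weight \<open>w\<close> has to satisfy \<open>b / g < w < a / c\<close>. The mediant of these two fractions is such a
  number, also in the degenerate case \<open>c = 0\<close>. The entries \<open>1 - a\<close> and \<open>1 - g\<close> may have either sign,
  hence the additional lower bound \<open>1 / 2\<close> for the rate.\<close>

lemma coupled_recursion_decay:
  fixes a b c g :: real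
  assumes pos: "0 < a" "0 \<le> b" "0 \<le> c" "0 < g" and det: "b * c < a * g"
  shows "\<exists>C>0. \<exists>\<rho>\<in>{0<..<1}. \<forall>u v.
    (\<forall>t. 0 \<le> u t \<and> 0 \<le> v t \<and>
         u (Suc t) \<le> (1 - a) * u t + b * v t \<and> v (Suc t) \<le> c * u t + (1 - g) * v t) \<longrightarrow>
    (\<forall>t. norm (vector [u t, v t] :: real ^ 2)
           \<le> C * \<rho> ^ t * norm (vector [u 0, v 0] :: real ^ 2))"
proof -
  define w where "w = (a + b) / (c + g)"
  have w0: "0 < w" using pos by (simp add: w_def)
  have wc: "w * c < a" and wg: "b < w * g"
    using pos det by (simp_all add: w_def field_simps)
  have b_div_w: "b / w < g" using wg w0 by (simp add: pos_divide_less_eq mult.commute)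
  define \<rho> where "\<rho> = max (1 / 2) (max (1 - a + w * c) (1 - g + b / w))"
  have \<rho>: "0 < \<rho>" "\<rho> < 1" and \<rho>u: "1 - a + w * c \<le> \<rho>" and \<rho>v: "1 - g + b / w \<le> \<rho>"
    using wc b_div_w by (auto simp: \<rho>_def)
  define C where "C = (1 + 1 / w) * (1 + w)"
  have "C > 0" using w0 by (auto simp: C_def intro!: mult_pos_pos add_pos_pos)
  moreover have "norm (vector [u t, v t] :: real ^ 2)
      \<le> C * \<rho> ^ t * norm (vector [u 0, v 0] :: real ^ 2)"
    if "\<forall>t. 0 \<le> u t \<and> 0 \<le> v t \<and>
         u (Suc t) \<le> (1 - a) * u t + b * v t \<and> v (Suc t) \<le> c * u t + (1 - g) * v t"
    for u v :: "nat \<Rightarrow> real" and t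
  proof -
    have u0: "0 \<le> u t" and v0: "0 \<le> v t"
      and u_step: "u (Suc t) \<le> (1 - a) * u t + b * v t"
      and v_step: "v (Suc t) \<le> c * u t + (1 - g) * v t" for t
      using that by auto
    have step: "u (Suc t) + w * v (Suc t) \<le> \<rho> * (u t + w * v t)" for t
    proof -
      have "u (Suc t) + w * v (Suc t)
          \<le> (1 - a) * u t + b * v t + w * (c * u t + (1 - g) * v t)"
        using u_step[of t] v_step[of t] w0 by (intro add_mono mult_left_mono) simp_all
      also have "\<dots> = (1 - a + w * c) * u t + (1 - g + b / w) * (w * v t)"
        using w0 by (simp add: field_simps)
      also have "\<dots> \<le> \<rho> * u t + \<rho> * (w * v t)"
        using \<rho>u \<rho>v u0[of t] v0[of t] w0 by (intro add_mono mult_right_mono) simp_all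
      finally show ?thesis by (simp add: distrib_left)
    qed
    have decay: "u t + w * v t \<le> \<rho> ^ t * (u 0 + w * v 0)" for t
    proof (induction t)
      case (Suc t)
      then have "\<rho> * (u t + w * v t) \<le> \<rho> * (\<rho> ^ t * (u 0 + w * v 0))"
        using \<rho> by (intro mult_left_mono) simp_all
      with step[of t] show ?case by (simp add: mult.assoc)
    qed simp
    have "norm (vector [u t, v t] :: real ^ 2) \<le> u t + v t"
      using u0[of t] v0[of t] by (simp add: norm_vector_2 sqrt_sum_squares_le_sum)
    also have "\<dots> \<le> (1 + 1 / w) * (u t + w * v t)"
      using u0[of t] v0[of t] w0 by (simp add: field_simps)
    also have "\<dots> \<le> (1 + 1 / w) * (\<rho> ^ t * (u 0 + w * v 0))"
      using decay w0 by (intro mult_left_mono) simp_all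
    also have "\<dots> \<le> (1 + 1 / w) * (\<rho> ^ t * ((1 + w) * norm (vector [u 0, v 0] :: real ^ 2)))"
    proof -
      have "u 0 + w * v 0 \<le> sqrt ((u 0)\<^sup>2 + (v 0)\<^sup>2) + w * sqrt ((u 0)\<^sup>2 + (v 0)\<^sup>2)"
        using w0 by (intro add_mono mult_left_mono real_le_rsqrt) simp_all
      then show ?thesis
        using w0 \<rho> by (intro mult_left_mono) (simp_all add: norm_vector_2 distrib_right)
    qed
    finally show ?thesis by (simp add: C_def mult_ac)
  qed
  ultimately show ?thesis using \<rho> by (intro exI[of _ C] conjI bexI[of _ \<rho>]) auto
qed

section \<open>The interconnected system\<close>

theorem theorem2:
  fixes normS :: "real ^ 'n \<Rightarrow> real" and normF :: "real ^ 'm \<Rightarrow> real"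
    and S :: "real ^ 'n \<Rightarrow> real ^ 'm \<Rightarrow> real ^ 'n"
    and F :: "real ^ 'n \<Rightarrow> real ^ 'm \<Rightarrow> real ^ 'm"
    and X :: "(real ^ 'n) set" and Z :: "(real ^ 'm) set"
    and Z_FIX :: "real ^ 'n \<Rightarrow> (real ^ 'm) set"
    and R :: "real ^ 'n \<Rightarrow> real ^ 'n"
    and X_fix :: "(real ^ 'n) set"
    and L_FIX c_F L_S L_R \<alpha> \<mu> c_S \<delta>_bar :: real
  assumes "is_inner_product_norm normS" and "is_inner_product_norm normF"
    and "closed X" and "closed Z"
    and "\<forall>x\<in>X. \<forall>z\<in>Z. \<forall>\<delta>'\<in>{0..1}. x + \<delta>' *\<^sub>R S x z \<in> X \<and> F x z \<in> Z"
    and "\<forall>x\<in>X. Z_FIX x \<subseteq> Z \<and> Z_FIX x \<noteq> {} \<and> closed (Z_FIX x)"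
    and "\<forall>x\<in>X. \<forall>z\<in>Z_FIX x. z = F x z"
    and "L_FIX > 0"
    and "\<forall>x\<in>X. \<forall>x'\<in>X. \<forall>z\<in>Z_FIX x.
           norm_infdist normF z (Z_FIX x') \<le> L_FIX * norm_dist normS x x'"
    and "c_F \<in> {0<..<1}"
    and "\<forall>x\<in>X. \<forall>z\<in>Z.
           norm_infdist normF (F x z) (Z_FIX x) \<le> c_F * norm_infdist normF z (Z_FIX x)"
    and "\<forall>x\<in>X. \<forall>z\<in>Z_FIX x. R x = S x z"
    and "L_S > 0" and "L_R > 0"
    and "\<forall>x\<in>X. \<forall>z\<in>Z. \<forall>z'\<in>Z. normS (S x z - S x z') \<le> L_S * normF (z - z')"
    and "\<forall>x\<in>X. \<forall>x'\<in>X. normS (R x - R x') \<le> L_R * normS (x - x')"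
    and "X_fix = {x \<in> X. R x = 0}" and "X_fix \<noteq> {}" and "closed X_fix"
    and "\<alpha> \<in> {0<..<1}" and "\<mu> \<ge> 1"
    and "\<forall>x\<in>X. \<forall>x'\<in>X.
           norm_dist normS (x + (1 / \<alpha>) *\<^sub>R R x) (x' + (1 / \<alpha>) *\<^sub>R R x') \<le> normS (x - x')"
    and "\<forall>x\<in>X. norm_infdist normS x X_fix \<le> \<mu> * normS (R x)"
    and "c_S = 1 - sqrt (1 - (1 - \<alpha>) / (\<alpha> * \<mu>\<^sup>2))"
    and "\<delta>_bar = c_S * (1 - c_F) / (L_FIX * L_S * (c_S + L_R))"
  shows "\<forall>\<delta>\<in>{0<..<min \<delta>_bar 1}. \<exists>C>0. \<exists>\<rho>\<in>{0<..<1}.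
           \<forall>x z. is_trajectory \<delta> S F x z \<and> x 0 \<in> X \<and> z 0 \<in> Z \<longrightarrow>
             (\<forall>t. norm (vector [norm_infdist normS (x t) X_fix,
                                norm_infdist normF (z t) (Z_FIX (x t))] :: real ^ 2)
                  \<le> C * \<rho> ^ t *
                    norm (vector [norm_infdist normS (x 0) X_fix,
                                  norm_infdist normF (z 0) (Z_FIX (x 0))] :: real ^ 2))"
proof
  fix \<delta> assume "\<delta> \<in> {0<..<min \<delta>_bar 1}"
  then have \<delta>: "0 < \<delta>" "\<delta> < 1" "\<delta> < \<delta>_bar" by auto
  note NS = assms(1) and NF = assms(2) and L_FIX = assms(8) and L_S = assms(13) and L_R = assms(14)
  have invariant: "x + \<delta>' *\<^sub>R S x z \<in> X" "F x z \<in> Z"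
    if "x \<in> X" "z \<in> Z" "0 \<le> \<delta>'" "\<delta>' \<le> 1" for x z \<delta>'
    using assms(5) that by auto
  have Z_FIX: "Z_FIX x \<subseteq> Z" "Z_FIX x \<noteq> {}" if "x \<in> X" for x
    using assms(6) that by auto
  have \<alpha>: "0 < \<alpha>" "\<alpha> < 1" and "0 < \<mu>" and c_F: "0 < c_F" "c_F < 1"
    using assms(10,20,21) by auto
  have X_fix: "X_fix \<noteq> {}" by (fact assms(18))
  have c_S: "0 < c_S"
    unfolding assms(24) using \<alpha> \<open>0 < \<mu>\<close> by (rule contraction_rate_pos)

  let ?d = "\<lambda>x. norm_infdist normS x X_fix"
  let ?e = "\<lambda>x z. norm_infdist normF z (Z_FIX x)"

  have R_le: "normS (R x) \<le> L_R * ?d x" if x: "x \<in> X" for x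
  proof (rule le_at_norm_infdist[OF NS X_fix])
    show "normS (R x) \<le> L_R * normS (x - y)" if "y \<in> X_fix" for y
    proof -
      have "y \<in> X" "R y = 0" using that assms(17) by auto
      moreover have "normS (R x - R y) \<le> L_R * normS (x - y)"
        using assms(16) x \<open>y \<in> X\<close> by blast
      ultimately show ?thesis by simp
    qed
  qed (intro continuous_intros)

  have S_R_le: "normS (S x z - R x) \<le> L_S * ?e x z" if "x \<in> X" "z \<in> Z" for x z
  proof (rule slow_field_error_le[OF NF, where Z = Z])
    show "normS (S x z - S x z') \<le> L_S * normF (z - z')" if "z' \<in> Z" for z'
      using assms(15) that \<open>x \<in> X\<close> \<open>z \<in> Z\<close> by blast
    show "S x z' = R x" if "z' \<in> Z_FIX x" for z'
      using assms(12) that \<open>x \<in> X\<close> by simp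
  qed (use Z_FIX that L_S in auto)

  have S_le: "normS (S x z) \<le> L_R * ?d x + L_S * ?e x z" if "x \<in> X" "z \<in> Z" for x z
    using inner_product_norm_triangle[OF NS, of "R x" "S x z - R x"] R_le[OF that(1)] S_R_le[OF that]
    by simp

  have slow: "?d (x + \<delta> *\<^sub>R S x z) \<le> (1 - \<delta> * c_S) * ?d x + \<delta> * L_S * ?e x z"
    if "x \<in> X" "z \<in> Z" for x z
  proof -
    have "?d (x + \<delta> *\<^sub>R R x) \<le> (1 - \<delta> * c_S) * ?d x"
    proof (rule relaxed_step_contraction[OF NS X_fix \<alpha> \<open>0 < \<mu>\<close> _ _ _ _ assms(24)])
      show "normS (x - y + (1 / \<alpha>) *\<^sub>R R x) \<le> normS (x - y)" if "y \<in> X_fix" for y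
      proof -
        have "y \<in> X" "R y = 0" using that assms(17) by auto
        moreover have "norm_dist normS (x + (1 / \<alpha>) *\<^sub>R R x) (y + (1 / \<alpha>) *\<^sub>R R y) \<le> normS (x - y)"
          using assms(22) \<open>x \<in> X\<close> \<open>y \<in> X\<close> by blast
        ultimately show ?thesis by (simp add: norm_dist_def algebra_simps)
      qed
      show "?d x \<le> \<mu> * normS (R x)" using assms(23) \<open>x \<in> X\<close> by blast
    qed (use \<delta> in simp_all)
    moreover have "?d (x + \<delta> *\<^sub>R S x z) \<le> ?d (x + \<delta> *\<^sub>R R x) + \<delta> * normS (S x z - R x)"
      using norm_infdist_triangle[OF NS X_fix, of "x + \<delta> *\<^sub>R S x z" "x + \<delta> *\<^sub>R R x"] \<delta>
      by (simp add: inner_product_norm_scaleR[OF NS] flip: scaleR_diff_right)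
    moreover have "\<delta> * normS (S x z - R x) \<le> \<delta> * (L_S * ?e x z)"
      using S_R_le[OF that] \<delta> by (intro mult_left_mono) simp_all
    ultimately show ?thesis by (simp add: mult.assoc)
  qed

  have fast: "?e (x + \<delta> *\<^sub>R S x z) (F x z)
      \<le> \<delta> * L_FIX * L_R * ?d x + (c_F + \<delta> * L_FIX * L_S) * ?e x z"
    if "x \<in> X" "z \<in> Z" for x z
  proof -
    let ?x' = "x + \<delta> *\<^sub>R S x z"
    have x': "?x' \<in> X" using that \<delta> by (intro invariant) simp_all
    have "normS (x - ?x') = \<delta> * normS (S x z)"
      using \<delta> by (simp add: inner_product_norm_minus[OF NS] inner_product_norm_scaleR[OF NS])
    then have "norm_infdist normF y (Z_FIX ?x') \<le> L_FIX * (\<delta> * normS (S x z))"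
      if "y \<in> Z_FIX x" for y
      using assms(9) x' \<open>x \<in> X\<close> that by (metis norm_dist_def)
    then have "?e ?x' (F x z) \<le> ?e x (F x z) + L_FIX * (\<delta> * normS (S x z))"
      by (rule norm_infdist_change_set[OF NF Z_FIX(2)[OF that(1)] Z_FIX(2)[OF x']])
    also have "\<dots> \<le> c_F * ?e x z + L_FIX * (\<delta> * (L_R * ?d x + L_S * ?e x z))"
      using assms(11) that S_le[OF that] L_FIX \<delta> by (intro add_mono mult_left_mono) simp_all
    finally show ?thesis by (simp add: algebra_simps)
  qed

  \<comment> \<open>The step size bound, cleared of its denominator, is the determinant condition of the recursion
    divided by \<open>\<delta>\<close>.\<close>
  have "\<delta> * (L_FIX * L_S * (c_S + L_R)) < c_S * (1 - c_F)"
    using \<delta>(3) L_FIX L_S L_R c_S unfolding assms(25) by (simp add: pos_less_divide_eq)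
  then have gap: "\<delta> * L_FIX * L_S * L_R < c_S * (1 - c_F - \<delta> * L_FIX * L_S)"
    by (simp add: algebra_simps)
  have g: "0 < 1 - c_F - \<delta> * L_FIX * L_S"
  proof -
    have "0 < \<delta> * L_FIX * L_S * L_R" using \<delta> L_FIX L_S L_R by simp
    with gap have "0 < c_S * (1 - c_F - \<delta> * L_FIX * L_S)" by linarith
    with c_S show ?thesis by (simp add: zero_less_mult_iff)
  qed
  have det: "\<delta> * L_S * (\<delta> * L_FIX * L_R) < \<delta> * c_S * (1 - c_F - \<delta> * L_FIX * L_S)"
    using mult_strict_left_mono[OF gap \<delta>(1)] by (simp add: mult_ac)
  have entries: "0 < \<delta> * c_S" "0 \<le> \<delta> * L_S" "0 \<le> \<delta> * L_FIX * L_R"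
    using \<delta> c_S L_S L_FIX L_R by simp_all
  obtain C \<rho> where "C > 0" and "\<rho> \<in> {0<..<1}" and decay: "\<And>u v t.
      (\<And>t. 0 \<le> u t \<and> 0 \<le> v t \<and> u (Suc t) \<le> (1 - \<delta> * c_S) * u t + \<delta> * L_S * v t \<and>
        v (Suc t) \<le> \<delta> * L_FIX * L_R * u t + (1 - (1 - c_F - \<delta> * L_FIX * L_S)) * v t) \<Longrightarrow>
      norm (vector [u t, v t] :: real ^ 2) \<le> C * \<rho> ^ t * norm (vector [u 0, v 0] :: real ^ 2)"
    using coupled_recursion_decay[OF entries g det] by blast

  have "norm (vector [?d (x t), ?e (x t) (z t)] :: real ^ 2)
      \<le> C * \<rho> ^ t * norm (vector [?d (x 0), ?e (x 0) (z 0)] :: real ^ 2)"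
    if "is_trajectory \<delta> S F x z" "x 0 \<in> X" "z 0 \<in> Z" for x z t
  proof (rule decay[where u = "\<lambda>t. ?d (x t)" and v = "\<lambda>t. ?e (x t) (z t)"])
    fix t
    have next_state: "x (Suc t) = x t + \<delta> *\<^sub>R S (x t) (z t)" "z (Suc t) = F (x t) (z t)" for t
      using that(1) by (auto simp: is_trajectory_def)
    have "x t \<in> X \<and> z t \<in> Z" for t
    proof (induction t)
      case (Suc t)
      then show ?case
        using \<delta> invariant[of "x t" "z t" \<delta>] by (simp add: next_state)
    qed (use that(2,3) in simp)
    then have xz: "x t \<in> X" "z t \<in> Z" by auto
    show "0 \<le> ?d (x t) \<and> 0 \<le> ?e (x t) (z t) \<and>
        ?d (x (Suc t)) \<le> (1 - \<delta> * c_S) * ?d (x t) + \<delta> * L_S * ?e (x t) (z t) \<and>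
        ?e (x (Suc t)) (z (Suc t)) \<le> \<delta> * L_FIX * L_R * ?d (x t)
          + (1 - (1 - c_F - \<delta> * L_FIX * L_S)) * ?e (x t) (z t)"
      using slow[OF xz] fast[OF xz] norm_infdist_nonneg[OF NS X_fix]
        norm_infdist_nonneg[OF NF Z_FIX(2)[OF xz(1)]]
      by (simp add: next_state)
  qed
  with \<open>C > 0\<close> \<open>\<rho> \<in> {0<..<1}\<close>
  show "\<exists>C>0. \<exists>\<rho>\<in>{0<..<1}.
           \<forall>x z. is_trajectory \<delta> S F x z \<and> x 0 \<in> X \<and> z 0 \<in> Z \<longrightarrow>
             (\<forall>t. norm (vector [norm_infdist normS (x t) X_fix,
                                norm_infdist normF (z t) (Z_FIX (x t))] :: real ^ 2)
                  \<le> C * \<rho> ^ t *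
                    norm (vector [norm_infdist normS (x 0) X_fix,
                                  norm_infdist normF (z 0) (Z_FIX (x 0))] :: real ^ 2))"
    by blast
qed

end
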